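(* Let $\mathcal{H}_1,\mathcal{H}_2$ be Hilbert spaces (not necessarily separable) and, for $i=1,2$, let $T_i:\mathcal{H}_i\to\mathcal{H}_i$ be a bounded normal operator. Suppose that there exist linear isometries $U_1:\mathcal{H}_1\to\mathcal{H}_2$ and $U_2:\mathcal{H}_2\to\mathcal{H}_1$ (not assumed surjective) such that $T_1U_2=U_2T_2$ and $T_2U_1=U_1T_1$. Then $T_1$ and $T_2$ are unitarily equivalent, that is, there is a unitary transformation $U:\mathcal{H}_1\to\mathcal{H}_2$ such that $UT_1=T_2U$.
   Context: Hilbert spaces are over $\mathbb{C}$. A bounded operator $T$ is normal if $TT^*=T^*T$. A unitary transformation is a surjective linear isometry between Hilbert spaces. *)

theory Defs
  imports "HOL-Analysis.Analysis"
begin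

text \<open>
  A complex inner product space carries the real inner product given by the real part of the
  complex one.  The library class \<^class>\<open>real_inner\<close> then supplies the norm
  \<open>\<parallel>x\<parallel> = sqrt (Re \<langle>x, x\<rangle>)\<close>, the metric and the topology, and positive definiteness.
  The complex inner product is linear in its first argument.
\<close>

class complex_inner = real_inner +
  fixes scaleC :: "complex \<Rightarrow> 'a \<Rightarrow> 'a"
    and cinner :: "'a \<Rightarrow> 'a \<Rightarrow> complex"
  assumes scaleC_add_right: "scaleC c (x + y) = scaleC c x + scaleC c y"
    and scaleC_add_left: "scaleC (c + d) x = scaleC c x + scaleC d x"
    and scaleC_scaleC: "scaleC c (scaleC d x) = scaleC (c * d) x"
    and scaleC_of_real: "scaleC (complex_of_real r) x = r *\<^sub>R x"
    and cinner_add_left: "cinner (x + y) z = cinner x z + cinner y z"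
    and cinner_scaleC_left: "cinner (scaleC c x) y = c * cinner x y"
    and cinner_commute: "cinner x y = cnj (cinner y x)"
    and Re_cinner: "Re (cinner x y) = inner x y"

class chilbert_space = complex_inner + complete_space

lemma vector_space_scaleC: "vector_space (scaleC :: complex \<Rightarrow> 'a::complex_inner \<Rightarrow> 'a)"
proof
  show "scaleC 1 x = x" for x :: 'a
    using scaleC_of_real[of 1 x] by simp
qed (rule scaleC_add_right scaleC_add_left scaleC_scaleC)+

lemma norm_eq_sqrt_cinner: "norm x = sqrt (Re (cinner x x))" for x :: "'a::complex_inner"
  by (simp add: Re_cinner norm_eq_sqrt_inner)

lemma cinner_self_eq_0_iff: "cinner x x = 0 \<longleftrightarrow> x = 0" for x :: "'a::complex_inner"
proof
  assume "cinner x x = 0"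
  then have "inner x x = 0" by (metis Re_cinner zero_complex.sel(1))
  then show "x = 0" by simp
next
  assume "x = 0"
  then show "cinner x x = 0"
    using cinner_add_left[of 0 0 "0::'a"] by simp
qed

instantiation complex :: chilbert_space
begin

definition scaleC_complex :: "complex \<Rightarrow> complex \<Rightarrow> complex" where
  "scaleC_complex c x = c * x"

definition cinner_complex :: "complex \<Rightarrow> complex \<Rightarrow> complex" where
  "cinner_complex x y = x * cnj y"

instance
  by standard
    (auto simp: scaleC_complex_def cinner_complex_def algebra_simps scaleR_conv_of_real inner_complex_def)

end

definition clinear :: "('a::complex_inner \<Rightarrow> 'b::complex_inner) \<Rightarrow> bool" where
  "clinear f \<longleftrightarrow> Vector_Spaces.linear scaleC scaleC f"

definition bounded_clinear :: "('a::complex_inner \<Rightarrow> 'b::complex_inner) \<Rightarrow> bool" where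
  "bounded_clinear f \<longleftrightarrow> clinear f \<and> (\<exists>K. \<forall>x. norm (f x) \<le> norm x * K)"

text \<open>
  For a bounded operator on a Hilbert space the adjoint exists by the Riesz representation theorem;
  it is unique because the inner product is definite.  The value is meaningful only in that case.
\<close>

definition cadjoint :: "('a::chilbert_space \<Rightarrow> 'b::chilbert_space) \<Rightarrow> 'b \<Rightarrow> 'a" where
  "cadjoint T = (THE S. \<forall>x y. cinner (T x) y = cinner x (S y))"

definition normal_operator :: "('a::chilbert_space \<Rightarrow> 'a) \<Rightarrow> bool" where
  "normal_operator T \<longleftrightarrow> bounded_clinear T \<and> T \<circ> cadjoint T = cadjoint T \<circ> T"

definition linear_isometry :: "('a::complex_inner \<Rightarrow> 'b::complex_inner) \<Rightarrow> bool" where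
  "linear_isometry U \<longleftrightarrow> clinear U \<and> (\<forall>x. norm (U x) = norm x)"

definition unitary :: "('a::complex_inner \<Rightarrow> 'b::complex_inner) \<Rightarrow> bool" where
  "unitary U \<longleftrightarrow> linear_isometry U \<and> surj U"

definition unitarily_equivalent ::
    "('a::complex_inner \<Rightarrow> 'a) \<Rightarrow> ('b::complex_inner \<Rightarrow> 'b) \<Rightarrow> bool" where
  "unitarily_equivalent S T \<longleftrightarrow> (\<exists>U. unitary U \<and> U \<circ> S = T \<circ> U)"

end

theory Submission
  imports Defs
begin

text \<open>
  Two ideas carry the proof.

  First, an isometry \<open>U\<close> with \<open>T\<^sub>1 U = U T\<^sub>2\<close>, both operators normal, automatically satisfies
  \<open>T\<^sub>1\<^sup>* U = U T\<^sub>2\<^sup>*\<close>, so its range reduces \<open>T\<^sub>1\<close> (lemma \<open>isometry_intertwines_adjoints\<close>).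
  Normality gives \<open>\<parallel>T\<^sub>1\<^sup>* U x\<parallel> = \<parallel>T\<^sub>1 U x\<parallel> = \<parallel>T\<^sub>2 x\<parallel> = \<parallel>T\<^sub>2\<^sup>* x\<parallel>\<close>, and moving \<open>T\<^sub>1\<^sup>*\<close> across
  the inner product gives \<open>\<langle>T\<^sub>1\<^sup>* U x, U T\<^sub>2\<^sup>* x\<rangle> = \<langle>T\<^sub>2\<^sup>* x, T\<^sub>2\<^sup>* x\<rangle>\<close>; hence
  \<open>\<parallel>T\<^sub>1\<^sup>* U x - U T\<^sub>2\<^sup>* x\<parallel>\<^sup>2 = 0\<close>.

  Second, there is a Schroeder-Bernstein construction for Hilbert spaces, in the style of
  Knaster and Tarski.  Put \<open>V = U\<^sub>2 U\<^sub>1\<close>, and let \<open>K\<close> be the least closed subspace of the first space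
  that contains \<open>(ran U\<^sub>2)\<^sup>\<bottom>\<close> and is invariant under \<open>V\<close>; let \<open>P\<close> be the projection onto \<open>K\<close>.
  The operator \<open>W = V P + (1 - P)\<close> is an isometry because \<open>V K \<subseteq> K\<close>.  Minimality of \<open>K\<close> forces
  \<open>K \<inter> ran U\<^sub>2 = V K\<close>, and this makes the range of \<open>W\<close> exactly \<open>ran U\<^sub>2\<close>.  Hence
  \<open>U = U\<^sub>2\<inverse> W\<close> is a surjective isometry.  An operator which, like its adjoint, commutes with \<open>V\<close>
  and preserves \<open>ran U\<^sub>2\<close> also preserves \<open>K\<close> (minimality again) and therefore commutes with \<open>P\<close>,
  so \<open>U\<close> intertwines every pair of operators that \<open>U\<^sub>1\<close> and \<open>U\<^sub>2\<close> intertwine along with their adjoints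
  (lemma \<open>Schroeder_Bernstein_isometries\<close>).

  All of this is done over the reals, for the inner product \<open>Re \<langle>x, y\<rangle>\<close>.  Multiplication by a complex
  number \<open>c\<close> is then one more operator, with adjoint multiplication by \<open>cnj c\<close>, so
  complex linearity of \<open>U\<close> is an instance of the intertwining property.
\<close>

section \<open>Orthogonal projection and adjoints\<close>

text \<open>
  The distance from \<open>x\<close> to \<open>M\<close> is attained: by the parallelogram law a minimising sequence is Cauchy.
  A minimiser \<open>p\<close> is the foot of the perpendicular, for otherwise moving \<open>p\<close> along
  a non-orthogonal direction in \<open>M\<close> would come closer to \<open>x\<close>.
\<close>

lemma orthogonal_projection_exists:
  fixes M :: "'a::{real_inner,complete_space} set"
  assumes "closed M" and M: "subspace M"
  shows "\<exists>p\<in>M. \<forall>m\<in>M. inner (x - p) m = 0"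
proof -
  define D where "D = Inf ((\<lambda>m. (norm (x - m))\<^sup>2) ` M)"
  have ne: "M \<noteq> {}"
    using subspace_0[OF M] by auto
  have bdd: "bdd_below ((\<lambda>m. (norm (x - m))\<^sup>2) ` M)"
    by (rule bdd_belowI[of _ 0]) auto
  have D_le: "D \<le> (norm (x - m))\<^sup>2" if "m \<in> M" for m
    unfolding D_def using that by (intro cInf_lower bdd) auto
  have "\<exists>m\<in>M. (norm (x - m))\<^sup>2 < D + 1 / (real n + 1)" for n :: nat
    using cInf_lessD[of "(\<lambda>m. (norm (x - m))\<^sup>2) ` M" "D + 1 / (real n + 1)"] ne
    by (auto simp: D_def)
  then obtain f where fM: "\<And>n. f n \<in> M"
    and f_near: "\<And>n. (norm (x - f n))\<^sup>2 < D + 1 / (real n + 1)"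
    by metis
  have gap: "(norm (f k - f l))\<^sup>2 \<le> 2 / (real k + 1) + 2 / (real l + 1)" for k l
  proof -
    have "(1/2) *\<^sub>R (f k + f l) \<in> M"
      using fM M by (simp add: subspace_add subspace_scale)
    then have "D \<le> (norm (x - (1/2) *\<^sub>R (f k + f l)))\<^sup>2"
      by (rule D_le)
    moreover have "(norm (f k - f l))\<^sup>2 = 2 * (norm (x - f k))\<^sup>2 + 2 * (norm (x - f l))\<^sup>2
        - 4 * (norm (x - (1/2) *\<^sub>R (f k + f l)))\<^sup>2"
      by (simp add: power2_norm_eq_inner inner_simps inner_commute algebra_simps)
    ultimately show ?thesis
      using f_near[of k] f_near[of l] by simp
  qed
  have "Cauchy f"
  proof (rule metric_CauchyI)
    fix e :: real assume e: "0 < e"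
    obtain N :: nat where N: "4 / e\<^sup>2 < real N"
      using reals_Archimedean2 by blast
    have small: "dist (f k) (f l) < e" if "N \<le> k" "N \<le> l" for k l
    proof -
      have tail: "2 / (real j + 1) < e\<^sup>2 / 2" if "N \<le> j" for j
      proof -
        have "4 < e\<^sup>2 * real N"
          using N e by (simp add: field_simps)
        also have "\<dots> \<le> e\<^sup>2 * (real j + 1)"
          using that by (intro mult_left_mono) auto
        finally show ?thesis by (simp add: field_simps)
      qed
      have "(norm (f k - f l))\<^sup>2 < e\<^sup>2"
        using gap[of k l] tail[OF that(1)] tail[OF that(2)] by linarith
      then show ?thesis
        using e by (simp add: dist_norm power_less_imp_less_base)
    qed
    then show "\<exists>N. \<forall>k\<ge>N. \<forall>l\<ge>N. dist (f k) (f l) < e" by blast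
  qed
  then obtain p where lim: "f \<longlonglongrightarrow> p"
    using Cauchy_convergent convergent_def by blast
  have pM: "p \<in> M"
    using closed_sequentially[OF \<open>closed M\<close> _ lim] fM by blast
  have "(\<lambda>n. (norm (x - f n))\<^sup>2) \<longlonglongrightarrow> (norm (x - p))\<^sup>2"
    by (intro tendsto_intros lim)
  moreover have "(\<lambda>n. D + 1 / (real n + 1)) \<longlonglongrightarrow> D"
    using tendsto_add[OF tendsto_const[of D] LIMSEQ_inverse_real_of_nat]
    by (simp add: field_simps)
  ultimately have p_min: "(norm (x - p))\<^sup>2 \<le> D"
    by (rule LIMSEQ_le) (use f_near less_imp_le in blast)
  have "inner (x - p) m = 0" if m: "m \<in> M" for m
  proof (rule ccontr)
    assume nz: "inner (x - p) m \<noteq> 0"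
    then have m0: "inner m m > 0" by auto
    \<comment> \<open>\<open>t m\<close> is the component of \<open>x - p\<close> along \<open>m\<close>.\<close>
    define t where "t = inner (x - p) m / inner m m"
    have "p + t *\<^sub>R m \<in> M"
      using pM m M by (simp add: subspace_add subspace_scale)
    then have "(norm (x - p))\<^sup>2 \<le> (norm (x - (p + t *\<^sub>R m)))\<^sup>2"
      using D_le p_min by (meson order_trans)
    also have "(norm (x - (p + t *\<^sub>R m)))\<^sup>2
        = (norm (x - p))\<^sup>2 - 2 * t * inner (x - p) m + t * (t * inner m m)"
      by (simp add: power2_norm_eq_inner inner_simps inner_commute algebra_simps)
    also have "t * inner m m = inner (x - p) m"
      using m0 by (simp add: t_def)
    finally have "t * inner (x - p) m \<le> 0" by simp
    moreover have "0 < t * inner (x - p) m"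
      using nz m0 by (simp add: t_def flip: power2_eq_square)
    ultimately show False by simp
  qed
  then show ?thesis using pM by blast
qed

text \<open>The vector representing \<open>f\<close> is a multiple of any nonzero vector orthogonal to the kernel of \<open>f\<close>.\<close>

lemma Riesz_representation:
  fixes f :: "'a::{real_inner,complete_space} \<Rightarrow> real"
  assumes f: "bounded_linear f"
  shows "\<exists>z. \<forall>x. f x = inner x z"
proof (cases "\<forall>x. f x = 0")
  case True
  then show ?thesis by (intro exI[of _ 0]) simp
next
  case False
  then obtain a where a: "f a \<noteq> 0" by blast
  interpret f: bounded_linear f by (rule f)
  have "closed {x. f x = 0}"
    by (rule closed_Collect_eq[OF linear_continuous_on[OF f] continuous_on_const])
  moreover have "subspace {x. f x = 0}"
    by (auto simp: subspace_def f.add f.scaleR f.zero)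
  ultimately obtain p where p: "f p = 0" and orth: "\<And>m. f m = 0 \<Longrightarrow> inner (a - p) m = 0"
    using orthogonal_projection_exists[of "{x. f x = 0}" a] by auto
  define e where "e = a - p"
  have fe: "f e \<noteq> 0" using a p by (simp add: e_def f.diff)
  then have ee: "inner e e \<noteq> 0" by (auto simp: f.zero)
  have "f x = inner x ((f e / inner e e) *\<^sub>R e)" for x
  proof -
    have "f (x - (f x / f e) *\<^sub>R e) = 0"
      using fe by (simp add: f.diff f.scaleR)
    then have "inner e (x - (f x / f e) *\<^sub>R e) = 0"
      using orth unfolding e_def by blast
    then have "inner x e = f x / f e * inner e e"
      by (simp add: inner_simps inner_commute)
    then show ?thesis using fe ee by simp
  qed
  then show ?thesis by blast
qed

definition adjoint_pair ::
    "('a::real_inner \<Rightarrow> 'b::real_inner) \<Rightarrow> ('b \<Rightarrow> 'a) \<Rightarrow> bool" where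
  "adjoint_pair S S' \<longleftrightarrow>
     bounded_linear S \<and> bounded_linear S' \<and> (\<forall>x y. inner (S x) y = inner x (S' y))"

lemma eq_if_inner_eq:
  fixes x y :: "'a::real_inner"
  assumes "\<And>z. inner z x = inner z y"
  shows "x = y"
proof -
  have "inner (x - y) (x - y) = 0"
    using assms[of "x - y"] by (simp add: inner_diff_right)
  then show ?thesis by simp
qed

lemma adjoint_exists:
  fixes T :: "'a::{real_inner,complete_space} \<Rightarrow> 'b::real_inner"
  assumes T: "bounded_linear T"
  shows "\<exists>S. adjoint_pair T S"
proof -
  have "\<exists>z. \<forall>x. inner (T x) y = inner x z" for y
    by (rule Riesz_representation[OF bounded_linear_compose[OF bounded_linear_inner_left T]])
  then obtain S where S: "\<And>x y. inner (T x) y = inner x (S y)" by metis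
  obtain K where "K \<ge> 0" and K: "\<And>x. norm (T x) \<le> norm x * K"
    using bounded_linear.nonneg_bounded[OF T] by blast
  have "bounded_linear S"
  proof (rule bounded_linear_intro)
    show "S (x + y) = S x + S y" for x y
      by (rule eq_if_inner_eq) (simp add: inner_add_right flip: S)
    show "S (r *\<^sub>R x) = r *\<^sub>R S x" for r x
      by (rule eq_if_inner_eq) (simp flip: S)
    show "norm (S y) \<le> norm y * K" for y
    proof (cases "S y = 0")
      case True
      then show ?thesis using \<open>K \<ge> 0\<close> by simp
    next
      case False
      have "norm (S y) * norm (S y) = inner (T (S y)) y"
        by (simp add: S norm_eq_sqrt_inner)
      also have "\<dots> \<le> norm (T (S y)) * norm y"
        by (rule norm_cauchy_schwarz)
      also have "\<dots> \<le> norm (S y) * K * norm y"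
        by (intro mult_right_mono K) simp
      finally show ?thesis using False by (simp add: mult.assoc mult.commute)
    qed
  qed
  then show ?thesis using T S by (auto simp: adjoint_pair_def)
qed

lemma adjoint_pair_commute: "adjoint_pair S S' \<Longrightarrow> adjoint_pair S' S"
  by (simp add: adjoint_pair_def inner_commute)

definition orth_proj :: "'a::real_inner set \<Rightarrow> 'a \<Rightarrow> 'a" where
  "orth_proj K x = (SOME p. p \<in> K \<and> (\<forall>k\<in>K. inner (x - p) k = 0))"

lemma
  fixes K :: "'a::{real_inner,complete_space} set"
  assumes "closed K" "subspace K"
  shows orth_proj_in: "orth_proj K x \<in> K"
    and orth_proj_orthogonal: "k \<in> K \<Longrightarrow> inner (x - orth_proj K x) k = 0"
proof -
  have "\<exists>p. p \<in> K \<and> (\<forall>k\<in>K. inner (x - p) k = 0)"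
    using orthogonal_projection_exists[OF assms] by blast
  then have "orth_proj K x \<in> K \<and> (\<forall>k\<in>K. inner (x - orth_proj K x) k = 0)"
    unfolding orth_proj_def by (rule someI_ex)
  then show "orth_proj K x \<in> K" and "k \<in> K \<Longrightarrow> inner (x - orth_proj K x) k = 0"
    by auto
qed

lemma orth_proj_eqI:
  fixes K :: "'a::{real_inner,complete_space} set"
  assumes K: "closed K" "subspace K"
    and p: "p \<in> K" "\<And>k. k \<in> K \<Longrightarrow> inner (x - p) k = 0"
  shows "orth_proj K x = p"
proof -
  define d where "d = orth_proj K x - p"
  have d: "d \<in> K"
    unfolding d_def using orth_proj_in[OF K] p(1) by (intro subspace_diff K)
  have "inner d d = inner (x - p) d - inner (x - orth_proj K x) d"
    by (simp add: d_def inner_simps)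
  also have "\<dots> = 0"
    using p(2)[OF d] orth_proj_orthogonal[OF K d] by simp
  finally show ?thesis by (simp add: d_def)
qed

lemma linear_orth_proj:
  fixes K :: "'a::{real_inner,complete_space} set"
  assumes K: "closed K" "subspace K"
  shows "linear (orth_proj K)"
proof (rule linearI)
  show "orth_proj K (x + y) = orth_proj K x + orth_proj K y" for x y
  proof (rule orth_proj_eqI[OF K])
    show "orth_proj K x + orth_proj K y \<in> K"
      by (intro subspace_add K orth_proj_in)
    show "inner (x + y - (orth_proj K x + orth_proj K y)) k = 0" if "k \<in> K" for k
      using orth_proj_orthogonal[OF K that, of x] orth_proj_orthogonal[OF K that, of y]
      by (simp add: inner_simps)
  qed
  show "orth_proj K (r *\<^sub>R x) = r *\<^sub>R orth_proj K x" for r x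
  proof (rule orth_proj_eqI[OF K])
    show "r *\<^sub>R orth_proj K x \<in> K"
      by (intro subspace_scale K orth_proj_in)
    show "inner (r *\<^sub>R x - r *\<^sub>R orth_proj K x) k = 0" if "k \<in> K" for k
      using orth_proj_orthogonal[OF K that, of x] by (simp flip: scaleR_diff_right)
  qed
qed

lemma orth_proj_reducing:
  fixes K :: "'a::{real_inner,complete_space} set"
  assumes K: "closed K" "subspace K"
    and S: "adjoint_pair S S'" "S ` K \<subseteq> K" "S' ` K \<subseteq> K"
  shows "orth_proj K (S x) = S (orth_proj K x)"
proof (rule orth_proj_eqI[OF K])
  show "S (orth_proj K x) \<in> K"
    using orth_proj_in[OF K] S(2) by blast
  show "inner (S x - S (orth_proj K x)) k = 0" if "k \<in> K" for k
  proof -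
    have "inner (S x - S (orth_proj K x)) k = inner (x - orth_proj K x) (S' k)"
      using S(1) by (simp add: adjoint_pair_def inner_diff_left)
    also have "\<dots> = 0"
      using S(3) that by (intro orth_proj_orthogonal K) blast
    finally show ?thesis .
  qed
qed

section \<open>Isometries\<close>

lemma inner_isometry:
  fixes U :: "'a::real_inner \<Rightarrow> 'b::real_inner"
  assumes "linear U" "\<And>x. norm (U x) = norm x"
  shows "inner (U x) (U y) = inner x y"
  by (simp add: dot_norm assms(2) flip: linear_add[OF assms(1)])

lemma closed_isometry_image:
  fixes U :: "'a::{real_inner,complete_space} \<Rightarrow> 'b::real_inner"
  assumes "linear U" "\<And>x. norm (U x) = norm x" "closed K" "subspace K"
  shows "closed (U ` K)"
proof -
  have "bounded_linear U"
    using assms(1,2) by (intro bounded_linear_intro[of _ 1]) (auto simp: linear_add linear_scale)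
  then have "complete (U ` K)"
    using assms by (intro complete_isometric_image[of 1]) (auto simp: complete_eq_closed)
  then show ?thesis by (rule complete_imp_closed)
qed

text \<open>
  The inner products \<open>\<langle>s, s\<rangle>\<close>, \<open>\<langle>u, u\<rangle>\<close> and \<open>\<langle>s, u\<rangle>\<close> of \<open>s = S1 (U x)\<close> and \<open>u = U (S2 x)\<close> all equal
  \<open>\<langle>S2 x, S2 x\<rangle>\<close>.  In terms of subspaces: an invariant subspace on which the restriction
  of a normal operator is normal is a reducing subspace.
\<close>

lemma isometry_intertwines_adjoints:
  fixes U :: "'b::real_inner \<Rightarrow> 'a::real_inner"
  assumes adj1: "adjoint_pair T1 S1" and normal1: "\<And>x. T1 (S1 x) = S1 (T1 x)"
    and adj2: "adjoint_pair T2 S2" and normal2: "\<And>x. T2 (S2 x) = S2 (T2 x)"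
    and U: "linear U" "\<And>x. norm (U x) = norm x"
    and TU: "\<And>x. T1 (U x) = U (T2 x)"
  shows "S1 (U x) = U (S2 x)"
proof -
  have move1: "inner (T1 a) b = inner a (S1 b)" "inner b (T1 a) = inner (S1 b) a" for a b
    using adj1 by (auto simp: adjoint_pair_def inner_commute)
  have move2: "inner (T2 a) b = inner a (S2 b)" "inner b (T2 a) = inner (S2 b) a" for a b
    using adj2 by (auto simp: adjoint_pair_def inner_commute)
  note U_inner = inner_isometry[OF U]
  define s u where "s = S1 (U x)" and "u = U (S2 x)"
  have same_norm1: "inner (S1 a) (S1 a) = inner (T1 a) (T1 a)" for a
    by (metis move1 normal1)
  have same_norm2: "inner (S2 a) (S2 a) = inner (T2 a) (T2 a)" for a
    by (metis move2 normal2)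
  have "inner s s = inner (S2 x) (S2 x)"
    by (simp add: s_def same_norm1 same_norm2 TU U_inner)
  moreover have "inner u u = inner (S2 x) (S2 x)"
    by (simp add: u_def U_inner)
  moreover have "inner u s = inner (S2 x) (S2 x)"
  proof -
    have "inner u s = inner (T1 u) (U x)"
      by (simp add: s_def move1)
    also have "\<dots> = inner (T2 (S2 x)) x"
      by (simp add: u_def TU U_inner)
    finally show ?thesis by (simp add: move2)
  qed
  ultimately have "inner (s - u) (s - u) = 0"
    by (simp add: inner_simps inner_commute)
  then show ?thesis by (simp add: s_def u_def)
qed

section \<open>The Schroeder-Bernstein construction\<close>

definition least_invariant_subspace :: "('a::real_normed_vector \<Rightarrow> 'a) \<Rightarrow> 'a set \<Rightarrow> 'a set" where
  "least_invariant_subspace V E =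
     \<Inter> {L. closed L \<and> subspace L \<and> E \<subseteq> L \<and> V ` L \<subseteq> L}"

lemma closed_least_invariant_subspace: "closed (least_invariant_subspace V E)"
  unfolding least_invariant_subspace_def by (rule closed_Inter) auto

lemma subspace_least_invariant_subspace: "subspace (least_invariant_subspace V E)"
  unfolding least_invariant_subspace_def by (rule subspace_Inter) auto

lemma least_invariant_subspace_base: "E \<subseteq> least_invariant_subspace V E"
  unfolding least_invariant_subspace_def by auto

lemma least_invariant_subspace_invariant:
  "x \<in> least_invariant_subspace V E \<Longrightarrow> V x \<in> least_invariant_subspace V E"
  unfolding least_invariant_subspace_def by blast

lemma least_invariant_subspace_least:
  assumes "closed L" "subspace L" "E \<subseteq> L" "V ` L \<subseteq> L"
  shows "least_invariant_subspace V E \<subseteq> L"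
  using assms unfolding least_invariant_subspace_def by blast

text \<open>The preimage of the subspace under \<open>S\<close> competes in the intersection that defines it.\<close>

lemma least_invariant_subspace_commuting:
  assumes S: "bounded_linear S" "S ` E \<subseteq> E" and comm: "\<And>x. S (V x) = V (S x)"
  shows "S ` least_invariant_subspace V E \<subseteq> least_invariant_subspace V E" (is "S ` ?K \<subseteq> ?K")
proof -
  have "?K \<subseteq> S -` ?K"
  proof (rule least_invariant_subspace_least)
    show "closed (S -` ?K)"
      by (rule continuous_closed_vimage[OF closed_least_invariant_subspace])
        (rule linear_continuous_at[OF S(1)])
    show "subspace (S -` ?K)"
      unfolding vimage_def
      by (rule linear_subspace_linear_preimage[OF bounded_linear.linear[OF S(1)]
            subspace_least_invariant_subspace])
    show "E \<subseteq> S -` ?K"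
      using S(2) least_invariant_subspace_base by blast
    show "V ` (S -` ?K) \<subseteq> S -` ?K"
      by (auto simp: comm least_invariant_subspace_invariant)
  qed
  then show ?thesis by blast
qed

text \<open>
  Here \<open>R\<close> plays the role of the range of \<open>U2\<close>, and \<open>K\<close> is generated by the orthogonal complement
  of \<open>R\<close>.  If \<open>r\<close> is the component of an element of \<open>K \<inter> R\<close> orthogonal to \<open>V K\<close>, then
  \<open>{k \<in> K. k \<bottom> r}\<close> contains both \<open>R\<^sup>\<bottom>\<close> and \<open>V K\<close>, so minimality gives \<open>r \<bottom> r\<close>.
\<close>

lemma least_invariant_subspace_Int_eq:
  fixes V :: "'a::{real_inner,complete_space} \<Rightarrow> 'a"
  assumes V: "linear V" "\<And>x. norm (V x) = norm x" "range V \<subseteq> R" and R: "subspace R"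
  defines "K \<equiv> least_invariant_subspace V {a. \<forall>y\<in>R. inner a y = 0}"
  shows "K \<inter> R = V ` K"
proof
  let ?E = "{a. \<forall>y\<in>R. inner a y = 0}"
  have K: "closed K" "subspace K"
    unfolding K_def by (rule closed_least_invariant_subspace subspace_least_invariant_subspace)+
  have VK: "V x \<in> K" if "x \<in> K" for x
    using that unfolding K_def by (rule least_invariant_subspace_invariant)
  show "V ` K \<subseteq> K \<inter> R" using VK V(3) by blast
  have VK_cl: "closed (V ` K)" "subspace (V ` K)"
    using V K by (auto intro!: closed_isometry_image linear_subspace_image)
  show "K \<inter> R \<subseteq> V ` K"
  proof
    fix x assume x: "x \<in> K \<inter> R"
    define r where "r = x - orth_proj (V ` K) x"
    have q: "orth_proj (V ` K) x \<in> V ` K" by (rule orth_proj_in[OF VK_cl])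
    then have r: "r \<in> K" "r \<in> R"
      unfolding r_def using x VK V(3) by (auto intro!: subspace_diff K R)
    have r_orth: "inner r (V k) = 0" if "k \<in> K" for k
      unfolding r_def using that by (intro orth_proj_orthogonal VK_cl) blast
    have "K \<subseteq> K \<inter> {k. inner r k = 0}"
      unfolding K_def
    proof (rule least_invariant_subspace_least, fold K_def)
      show "closed (K \<inter> {k. inner r k = 0})"
        by (intro closed_Int K closed_Collect_eq continuous_intros)
      show "subspace (K \<inter> {k. inner r k = 0})"
        by (intro subspace_inter K) (auto simp: subspace_def inner_simps)
      show "?E \<subseteq> K \<inter> {k. inner r k = 0}"
        using least_invariant_subspace_base[of ?E V] r(2) by (auto simp: K_def inner_commute)
      show "V ` (K \<inter> {k. inner r k = 0}) \<subseteq> K \<inter> {k. inner r k = 0}"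
        using VK r_orth by auto
    qed
    then have "r = 0" using r(1) by auto
    then show "x \<in> V ` K" using q by (simp add: r_def)
  qed
qed

text \<open>
  The map \<open>U\<close> is \<open>U2\<inverse> W\<close> with \<open>W = V P + (1 - P)\<close> and \<open>V = U2 U1\<close>.  The equations with
  \<open>S2\<close> and \<open>S2'\<close> say that \<open>S1\<close> and \<open>S1'\<close> preserve the range of \<open>U2\<close> and commute with \<open>V\<close>; hence they
  preserve \<open>K\<close>, so \<open>S1\<close> commutes with \<open>P\<close> and with \<open>W\<close>.  The conclusion covers all such operators
  with one and the same \<open>U\<close>, so that the complex scalars can be treated along with \<open>T1\<close>.
\<close>

lemma Schroeder_Bernstein_isometries:
  fixes U1 :: "'a::{real_inner,complete_space} \<Rightarrow> 'b::{real_inner,complete_space}"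
    and U2 :: "'b \<Rightarrow> 'a"
  assumes U1: "linear U1" "\<And>x. norm (U1 x) = norm x"
    and U2: "linear U2" "\<And>y. norm (U2 y) = norm y"
  obtains U where "linear U" "\<And>x. norm (U x) = norm x" "surj U"
    "\<And>S1 S1' S2 S2' x. \<lbrakk>adjoint_pair S1 S1';
        \<And>x. U1 (S1 x) = S2 (U1 x); \<And>x. U1 (S1' x) = S2' (U1 x);
        \<And>y. U2 (S2 y) = S1 (U2 y); \<And>y. U2 (S2' y) = S1' (U2 y)\<rbrakk> \<Longrightarrow> U (S1 x) = S2 (U x)"
proof -
  define V where "V = U2 \<circ> U1"
  have V: "linear V" "\<And>x. norm (V x) = norm x" "range V \<subseteq> range U2"
    unfolding V_def using U1 U2 by (auto intro: linear_compose)
  have R: "closed (range U2)" "subspace (range U2)"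
    using U2 by (auto intro!: closed_isometry_image linear_subspace_image)
  define E where "E = {a. \<forall>y\<in>range U2. inner a y = 0}"
  define K where "K = least_invariant_subspace V E"
  have K: "closed K" "subspace K"
    unfolding K_def by (rule closed_least_invariant_subspace subspace_least_invariant_subspace)+
  have VK: "V x \<in> K" if "x \<in> K" for x
    using that unfolding K_def by (rule least_invariant_subspace_invariant)
  have KR: "K \<inter> range U2 = V ` K"
    unfolding K_def E_def by (rule least_invariant_subspace_Int_eq[OF V R(2)])
  have compl_K: "x \<in> range U2" if "\<And>k. k \<in> K \<Longrightarrow> inner x k = 0" for x
  proof -
    define e where "e = x - orth_proj (range U2) x"
    have e_orth: "inner e y = 0" if "y \<in> range U2" for y
      unfolding e_def by (rule orth_proj_orthogonal[OF R that])
    then have "e \<in> K"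
      using least_invariant_subspace_base[of E V] by (auto simp: K_def E_def)
    then have "inner x e = 0" by (rule that)
    moreover have "inner e e = inner x e - inner e (orth_proj (range U2) x)"
      by (simp add: e_def inner_simps inner_commute)
    ultimately have "e = 0"
      using e_orth[OF orth_proj_in[OF R]] by simp
    then show ?thesis
      using orth_proj_in[OF R, of x] by (simp add: e_def)
  qed
  let ?P = "orth_proj K"
  define W where "W x = V (?P x) + (x - ?P x)" for x
  have P: "linear ?P" by (rule linear_orth_proj[OF K])
  have P_in: "?P x \<in> K" for x by (rule orth_proj_in[OF K])
  have P_orth: "inner (x - ?P x) k = 0" if "k \<in> K" for x k
    by (rule orth_proj_orthogonal[OF K that])
  have W_lin: "linear W"
    unfolding W_def
    by (intro linear_compose_add linear_compose_sub linear_ident P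
        linear_compose[OF P V(1), unfolded o_def])
  have W_norm: "norm (W x) = norm x" for x
  proof -
    have "(norm (W x))\<^sup>2 = (norm (V (?P x)))\<^sup>2 + (norm (x - ?P x))\<^sup>2"
      using P_orth[OF VK[OF P_in[of x]], of x]
      by (simp add: W_def power2_norm_eq_inner inner_add_left inner_add_right inner_commute)
    also have "\<dots> = (norm (?P x))\<^sup>2 + (norm (x - ?P x))\<^sup>2"
      by (simp add: V(2))
    also have "\<dots> = (norm (?P x + (x - ?P x)))\<^sup>2"
      using P_orth[OF P_in[of x], of x]
      by (simp only: power2_norm_eq_inner inner_add_left inner_add_right)
        (simp add: inner_commute)
    finally show ?thesis by simp
  qed
  have W_range: "range W = range U2"
  proof
    show "range W \<subseteq> range U2"
    proof (clarify)
      fix x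
      have "V (?P x) \<in> range U2" using V(3) by blast
      moreover have "x - ?P x \<in> range U2" using P_orth by (rule compl_K)
      ultimately show "W x \<in> range U2"
        unfolding W_def by (rule subspace_add[OF R(2)])
    qed
    show "range U2 \<subseteq> range W"
    proof
      fix y assume y: "y \<in> range U2"
      have "y - ?P y \<in> range U2" using P_orth by (rule compl_K)
      then have "y - (y - ?P y) \<in> range U2"
        by (rule subspace_diff[OF R(2) y])
      then have "?P y \<in> range U2" by simp
      then obtain k where k: "k \<in> K" "?P y = V k"
        using P_in[of y] KR by blast
      \<comment> \<open>\<open>W\<close> moves the \<open>K\<close>-component \<open>k\<close> to \<open>V k\<close> and fixes the orthogonal component \<open>y - ?P y\<close>.\<close>
      have "?P (k + (y - ?P y)) = k"
        using k(1) P_orth by (intro orth_proj_eqI K) auto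
      then have "W (k + (y - ?P y)) = y"
        by (simp add: W_def k(2))
      then show "y \<in> range W" by (metis rangeI)
    qed
  qed
  have inj: "inj U2"
    using U2 by (metis linear_injective_0 norm_eq_zero)
  define U where "U x = inv U2 (W x)" for x
  have U2U: "U2 (U x) = W x" for x
    unfolding U_def using W_range by (intro f_inv_into_f) auto
  show thesis
  proof
    show "linear U"
      by (rule linearI; rule injD[OF inj])
        (simp_all add: U2U linear_add[OF U2(1)] linear_add[OF W_lin]
          linear_scale[OF U2(1)] linear_scale[OF W_lin])
    show "norm (U x) = norm x" for x
      by (metis U2(2) U2U W_norm)
    show "surj U"
      unfolding surj_def
    proof
      fix y
      obtain x where "U2 y = W x" using W_range by (metis rangeE rangeI)
      then show "\<exists>x. y = U x" by (metis U2U injD[OF inj])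
    qed
    fix S1 S1' S2 S2' x
    assume adj: "adjoint_pair S1 S1'"
      and eq1: "\<And>x. U1 (S1 x) = S2 (U1 x)" and eq1': "\<And>x. U1 (S1' x) = S2' (U1 x)"
      and eq2: "\<And>y. U2 (S2 y) = S1 (U2 y)" and eq2': "\<And>y. U2 (S2' y) = S1' (U2 y)"
    have adj': "adjoint_pair S1' S1" by (rule adjoint_pair_commute[OF adj])
    have comm: "S1 (V x) = V (S1 x)" "S1' (V x) = V (S1' x)" for x
      by (simp_all add: V_def eq1 eq1' eq2 eq2')
    have "S1 ` E \<subseteq> E" "S1' ` E \<subseteq> E"
      using adj adj' by (auto simp: E_def adjoint_pair_def simp flip: eq2 eq2')
    then have "S1 ` K \<subseteq> K" "S1' ` K \<subseteq> K"
      unfolding K_def using adj comm unfolding adjoint_pair_def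
      by (metis least_invariant_subspace_commuting)+
    then have PS: "?P (S1 x) = S1 (?P x)"
      by (rule orth_proj_reducing[OF K adj])
    have S1_lin: "linear S1"
      using adj by (simp add: adjoint_pair_def bounded_linear.linear)
    have "U2 (U (S1 x)) = U2 (S2 (U x))"
      by (simp add: U2U eq2 W_def PS comm linear_add[OF S1_lin] linear_diff[OF S1_lin])
    then show "U (S1 x) = S2 (U x)" by (rule injD[OF inj])
  qed
qed

section \<open>Complex Hilbert spaces\<close>

lemma clinear_iff:
  "clinear f \<longleftrightarrow> (\<forall>x y. f (x + y) = f x + f y) \<and> (\<forall>c x. f (scaleC c x) = scaleC c (f x))"
  by (simp add: clinear_def Vector_Spaces.linear_iff vector_space_scaleC)

lemma clinear_imp_linear: "clinear f \<Longrightarrow> linear f"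
  by (rule linearI) (auto simp: clinear_iff simp flip: scaleC_of_real)

lemma bounded_clinear_imp_bounded_linear: "bounded_clinear f \<Longrightarrow> bounded_linear f"
  by (auto simp: bounded_clinear_def bounded_linear_def bounded_linear_axioms_def
      clinear_imp_linear)

lemma cinner_eq_Complex:
  "cinner x y = Complex (inner x y) (inner (scaleC (- \<i>) x) y)"
  by (simp add: complex_eq_iff cinner_scaleC_left flip: Re_cinner)

text \<open>
  An adjoint for the real inner product is one for the complex inner product, because
  \<open>Im \<langle>x, y\<rangle> = Re \<langle>-\<i> x, y\<rangle>\<close> and \<open>T\<close> commutes with multiplication by \<open>-\<i>\<close>.
\<close>

lemma adjoint_pair_cadjoint:
  assumes T: "bounded_clinear T"
  shows "adjoint_pair T (cadjoint T)"
proof -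
  obtain S where S: "adjoint_pair T S"
    using adjoint_exists[OF bounded_clinear_imp_bounded_linear[OF T]] by blast
  have TC: "T (scaleC c x) = scaleC c (T x)" for c x
    using T by (simp add: bounded_clinear_def clinear_iff)
  have "cadjoint T = S"
    unfolding cadjoint_def
  proof (rule the_equality)
    show "\<forall>x y. cinner (T x) y = cinner x (S y)"
      using S by (simp add: cinner_eq_Complex adjoint_pair_def flip: TC)
    show "S' = S" if S': "\<forall>x y. cinner (T x) y = cinner x (S' y)" for S'
    proof (rule ext, rule eq_if_inner_eq)
      show "inner x (S' y) = inner x (S y)" for x y
        using S S' by (metis Re_cinner adjoint_pair_def)
    qed
  qed
  then show ?thesis using S by simp
qed

lemma adjoint_pair_scaleC:
  fixes c :: complex
  shows "adjoint_pair (scaleC c :: 'a::complex_inner \<Rightarrow> 'a) (scaleC (cnj c))"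
proof -
  have right: "cinner x (scaleC d y) = cnj d * cinner x y" for d and x y :: 'a
    by (metis cinner_commute cinner_scaleC_left complex_cnj_mult)
  have bounded: "bounded_linear (scaleC d :: 'a \<Rightarrow> 'a)" for d
  proof (rule bounded_linear_intro)
    show "scaleC d (r *\<^sub>R x) = r *\<^sub>R scaleC d x" for r and x :: 'a
      by (simp add: scaleC_scaleC mult.commute flip: scaleC_of_real)
    show "norm (scaleC d x) \<le> norm x * cmod d" for x :: 'a
    proof -
      have "(norm (scaleC d x))\<^sup>2 = Re ((d * cnj d) * cinner x x)"
        by (simp add: power2_norm_eq_inner cinner_scaleC_left right ac_simps
            flip: Re_cinner del: times_complex.sel)
      also have "\<dots> = (cmod d * norm x)\<^sup>2"
        by (simp add: power2_norm_eq_inner power_mult_distrib Re_cinner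
            flip: complex_norm_square of_real_power)
      finally show ?thesis
        by (simp add: mult.commute)
    qed
  qed (rule scaleC_add_right)
  show ?thesis
    unfolding adjoint_pair_def
    by (intro conjI bounded) (simp add: cinner_scaleC_left right flip: Re_cinner)
qed

theorem theorem2p8:
  fixes T1 :: "'a::chilbert_space \<Rightarrow> 'a"
    and T2 :: "'b::chilbert_space \<Rightarrow> 'b"
    and U1 :: "'a \<Rightarrow> 'b"
    and U2 :: "'b \<Rightarrow> 'a"
  assumes "normal_operator T1"
    and "normal_operator T2"
    and "linear_isometry U1"
    and "linear_isometry U2"
    and "T1 \<circ> U2 = U2 \<circ> T2"
    and "T2 \<circ> U1 = U1 \<circ> T1"
  shows "unitarily_equivalent T1 T2"
proof -
  have adj1: "adjoint_pair T1 (cadjoint T1)" and adj2: "adjoint_pair T2 (cadjoint T2)"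
    using assms(1,2) by (auto simp: normal_operator_def intro: adjoint_pair_cadjoint)
  have normal1: "T1 (cadjoint T1 x) = cadjoint T1 (T1 x)" for x
    using assms(1) by (simp add: normal_operator_def fun_eq_iff)
  have normal2: "T2 (cadjoint T2 x) = cadjoint T2 (T2 x)" for x
    using assms(2) by (simp add: normal_operator_def fun_eq_iff)
  have U1: "linear U1" "\<And>x. norm (U1 x) = norm x" "\<And>c x. U1 (scaleC c x) = scaleC c (U1 x)"
    and U2: "linear U2" "\<And>y. norm (U2 y) = norm y" "\<And>c y. U2 (scaleC c y) = scaleC c (U2 y)"
    using assms(3,4) by (auto simp: linear_isometry_def clinear_imp_linear clinear_iff)
  have TU2: "T1 (U2 y) = U2 (T2 y)" for y
    using assms(5) by (simp add: fun_eq_iff)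
  have TU1: "T2 (U1 x) = U1 (T1 x)" for x
    using assms(6) by (simp add: fun_eq_iff)
  have adj_U2: "cadjoint T1 (U2 y) = U2 (cadjoint T2 y)" for y
    by (rule isometry_intertwines_adjoints[OF adj1 normal1 adj2 normal2 U2(1,2) TU2])
  have adj_U1: "cadjoint T2 (U1 x) = U1 (cadjoint T1 x)" for x
    by (rule isometry_intertwines_adjoints[OF adj2 normal2 adj1 normal1 U1(1,2) TU1])
  obtain U where U: "linear U" "\<And>x. norm (U x) = norm x" "surj U"
    and intertwines: "\<And>S1 S1' S2 S2' x. \<lbrakk>adjoint_pair S1 S1';
        \<And>x. U1 (S1 x) = S2 (U1 x); \<And>x. U1 (S1' x) = S2' (U1 x);
        \<And>y. U2 (S2 y) = S1 (U2 y); \<And>y. U2 (S2' y) = S1' (U2 y)\<rbrakk> \<Longrightarrow> U (S1 x) = S2 (U x)"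
    using Schroeder_Bernstein_isometries[OF U1(1,2) U2(1,2)] by blast
  have "U (T1 x) = T2 (U x)" for x
    by (rule intertwines[OF adj1, where S2' = "cadjoint T2"]) (simp_all add: TU1 TU2 adj_U1 adj_U2)
  moreover have "U (scaleC c x) = scaleC c (U x)" for c x
    by (rule intertwines[OF adjoint_pair_scaleC, where S2' = "scaleC (cnj c)"]) (simp_all add: U1(3) U2(3))
  ultimately show ?thesis
    unfolding unitarily_equivalent_def unitary_def linear_isometry_def clinear_iff
    using U by (intro exI[of _ U]) (simp add: fun_eq_iff linear_add)
qed

end
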